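(* Let $C_1,C_2\in\mathbb{N}$ and $\beta_1,\beta_2,\ell\in\mathbb{N}$ with $\log_2 C_1\le\beta_1$ and $\log_2 C_2\le\beta_2$. Call a prime $p$ useful if $p\nmid C_1$ and $(p-1)\nmid C_2$. Let $\mu>0$ be a constant such that for all $n>\mu$ and for all integers $q\in\{n,\dots,2n\}$ with fewer than $\mu n/\log^2 n$ exceptions, $S(q)<q^{1.89}$. Define $\Upsilon(x)=\frac{3x}{5\log x}-\frac{\mu x}{\log^2 x}$. Let $n$ be the smallest integer such that $n>21$, $n>\mu$ and $\Upsilon(n)>\beta_1+\beta_2+\ell$. Define $$\mathcal{Q}=\{q \text{ prime}: n\le q<2n \text{ and } S(q)<q^{1.89}\},\qquad \mathcal{P}=\{S(q): q\in\mathcal{Q}\}.$$ Then the number of primes in $\mathcal{P}$ is at least $\beta_1+\beta_2+\ell$, the number of useful primes in $\mathcal{P}$ is at least $\ell$, and every $p\in\mathcal{P}$ satisfies $p\in O\big((\beta_1+\beta_2+\ell)^{1.89}\log^{1.89}(\beta_1+\beta_2+\ell)\big)$.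
   Context: For an integer $q$, $S(q)$ denotes the smallest prime $p$ such that $q\mid (p-1)$. Here $\log$ denotes the natural logarithm. *)

theory Defs
  imports "HOL-Analysis.Analysis" "HOL-Computational_Algebra.Primes"
begin

definition S :: "nat \<Rightarrow> nat" where
  "S q = (LEAST p. prime p \<and> q dvd (p - 1))"

definition Upsilon :: "real \<Rightarrow> real \<Rightarrow> real" where
  "Upsilon \<mu> x = 3 * x / (5 * ln x) - \<mu> * x / (ln x)\<^sup>2"

text \<open>n: smallest integer with n > 21, n > mu and Upsilon(n) > s  (s = beta1+beta2+l).\<close>
definition nmin :: "real \<Rightarrow> nat \<Rightarrow> nat" where
  "nmin \<mu> s = (LEAST n::nat. n > 21 \<and> real n > \<mu> \<and> Upsilon \<mu> (real n) > real s)"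

definition Qset :: "real \<Rightarrow> nat \<Rightarrow> nat set" where
  "Qset \<mu> s = {q. prime q \<and> nmin \<mu> s \<le> q \<and> q < 2 * nmin \<mu> s
                  \<and> real (S q) < real q powr 1.89}"

definition Pset :: "real \<Rightarrow> nat \<Rightarrow> nat set" where
  "Pset \<mu> s = S ` Qset \<mu> s"

definition useful :: "nat \<Rightarrow> nat \<Rightarrow> nat \<Rightarrow> bool" where
  "useful C1 C2 p \<longleftrightarrow> prime p \<and> \<not> p dvd C1 \<and> \<not> (p - 1) dvd C2"

end

theory Submission
  imports
    Defs
    "HOL-Number_Theory.Pocklington"
    "HOL-Number_Theory.Prime_Powers"
    "HOL-Real_Asymp.Real_Asymp"
begin

text \<open>
  If \<open>q < r\<close> are primes with \<open>S q = S r = p\<close>, then \<open>q r\<close> divides \<open>p - 1\<close>, so \<open>p > q\<^sup>2\<close>; hence \<open>S\<close> is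
  injective on \<open>Q\<close> and it suffices to bound the size of \<open>Q\<close> from below. This reduces to the estimate
  of Rosser and Schoenfeld that \<open>[n, 2n)\<close> contains at least \<open>3 n / (5 ln n)\<close> primes for \<open>n > 21\<close>.

  For \<open>n \<ge> 4096\<close> this follows from Chebyshev's method. Writing \<open>\<psi>\<close> for the summatory function of the
  von Mangoldt function and \<open>A(n)\<close> for the logarithm of \<open>n! (n/30)! / ((n/2)! (n/3)! (n/5)!)\<close> (with
  rounded-down quotients), one has \<open>\<psi>(n) - \<psi>(n/6) \<le> A(n) \<le> \<psi>(n)\<close> and \<open>A(n) = c n + O(ln n)\<close> with
  \<open>c > 0.92\<close>, so \<open>\<psi>(2n) - \<psi>(n) \<ge> (2 - 6/5) c n - O(ln\<^sup>2 n)\<close>. The remaining \<open>n\<close> are covered by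
  intervals \<open>[a, b]\<close>, on each of which it suffices to count the primes in \<open>[b, 2a)\<close>.

  A prime \<open>p = S q\<close> with \<open>(p - 1) dvd C\<^sub>2\<close> yields the prime divisor \<open>q\<close> of \<open>C\<^sub>2\<close>, so at most
  \<open>\<beta>\<^sub>1 + \<beta>\<^sub>2\<close> of the primes found are not useful.
\<close>

section \<open>Chebyshev's estimates\<close>

text \<open>As a function of \<open>z\<close>, the left side is largest at \<open>z = y\<close>.
  This tangent inequality stands in for comparison with the integral of \<open>ln\<close>.\<close>

lemma mult_ln_minus_ge:
  fixes y z :: real
  assumes "y > 0" "z > 0"
  shows "y * ln z - z \<le> y * ln y - y"
proof -
  have "ln (z / y) \<le> z / y - 1"
    using assms by (intro ln_le_minus_one) auto
  then have "y * (ln z - ln y) \<le> y * (z / y - 1)"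
    using assms by (intro mult_left_mono) (auto simp: ln_div)
  then show ?thesis
    using assms by (simp add: algebra_simps)
qed

lemma ln_fact_ge: "m \<ge> 1 \<Longrightarrow> real m * ln m - m + 1 \<le> ln (fact m)"
proof (induction m rule: dec_induct)
  case (step m)
  have "real m * ln (Suc m) - Suc m \<le> real m * ln m - m"
    using step by (intro mult_ln_minus_ge) auto
  moreover have "ln (fact (Suc m)) = ln (Suc m) + ln (fact m :: real)"
    by (simp add: ln_mult)
  ultimately show ?case
    using step.IH by (simp add: algebra_simps)
qed auto

lemma ln_fact_le: "m \<ge> 1 \<Longrightarrow> ln (fact m) \<le> real m * ln m - m + 1 + ln m"
proof (induction m rule: dec_induct)
  case (step m)
  have "real (Suc m) * ln m - m \<le> real (Suc m) * ln (Suc m) - Suc m"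
    using step by (intro mult_ln_minus_ge) auto
  moreover have "ln (fact (Suc m)) = ln (Suc m) + ln (fact m :: real)"
    by (simp add: ln_mult)
  ultimately show ?case
    using step.IH by (simp add: algebra_simps)
qed auto

lemma real_div_bounds:
  fixes n k :: nat
  assumes "k > 0"
  shows "real (n div k) \<le> n / k" "n / k < real (n div k) + 1"
proof -
  show "real (n div k) \<le> n / k"
    by (rule of_nat_div_le_of_nat)
  have "n < k * (n div k + 1)"
    using assms dividend_less_times_div[of k n] by (simp add: algebra_simps)
  then have "real n < real k * (real (n div k) + 1)"
    by (metis of_nat_1 of_nat_add of_nat_less_iff of_nat_mult)
  then show "n / k < real (n div k) + 1"
    using assms by (simp add: field_simps)
qed

text \<open>With \<open>x = n / k\<close> and \<open>m = n div k\<close>, the tangent inequality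
  bounds \<open>x * ln m - m\<close> by \<open>x * ln x - x\<close>, so rounding adds no error of
  its own.\<close>

lemma ln_fact_div_le:
  fixes n k :: nat
  assumes "n \<ge> 1" "k \<ge> 1"
  shows "ln (fact (n div k)) \<le> n / k * ln (n / k) - n / k + 1 + ln n"
proof (cases "n div k = 0")
  case True
  \<comment> \<open>At \<open>z = 1\<close> the tangent inequality gives
    \<open>x * ln x - x + 1 \<ge> 0\<close>, which suffices because
    \<open>ln (fact 0) = 0\<close>.\<close>
  have "n / k * ln 1 - 1 \<le> n / k * ln (n / k) - n / k"
    using assms by (intro mult_ln_minus_ge) auto
  then show ?thesis
    using True assms ln_ge_zero[of "real n"] by simp
next
  case False
  define m where "m = n div k"
  have m: "m \<ge> 1" "m \<le> n"
    using False by (auto simp: m_def)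
  have le: "real m \<le> n / k"
    unfolding m_def using assms by (intro real_div_bounds) auto
  have "ln (fact m) \<le> real m * ln m - m + 1 + ln m"
    using m by (intro ln_fact_le)
  moreover have "ln m \<le> ln n"
    using m by simp
  moreover have "real m * ln m \<le> n / k * ln m"
    using le m by (intro mult_right_mono) auto
  moreover have "n / k * ln m - m \<le> n / k * ln (n / k) - n / k"
    using m assms by (intro mult_ln_minus_ge) auto
  ultimately show ?thesis
    unfolding m_def by linarith
qed

lemma ln_fact_div_ge:
  fixes n k :: nat
  assumes "n \<ge> 1" "k \<ge> 1"
  shows "n / k * ln (n / k) - n / k - ln n \<le> ln (fact (n div k))"
proof (cases "n / k \<ge> (1::real)")
  case False
  then have "n < k"
    using assms by (simp add: field_simps)
  moreover have "n / k * ln (n / k) \<le> 0"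
    using assms False by (intro mult_nonneg_nonpos) auto
  moreover have "ln n \<ge> 0" "real n / k \<ge> 0"
    using assms by auto
  moreover have "ln (fact (n div k)) = (0::real)"
    using \<open>n < k\<close> by simp
  ultimately show ?thesis
    by linarith
next
  case True
  define m where "m = n div k"
  have less: "n / k < real (Suc m)"
    unfolding m_def using assms real_div_bounds(2)[of k n] by simp
  \<comment> \<open>The factorial bound is applied to \<open>Suc m\<close>, which exceeds
    \<open>n / k\<close>. Removing the factor \<open>Suc m\<close> costs at most
    \<open>ln n + 1\<close>, and this 1 cancels the one in \<open>ln_fact_ge\<close>.\<close>
  have "n / k * ln (n / k) \<le> Suc m * ln (n / k)"
    using less True by (intro mult_right_mono) auto
  moreover have "Suc m * ln (n / k) - n / k \<le> Suc m * ln (Suc m) - Suc m"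
    using True assms by (intro mult_ln_minus_ge) auto
  moreover have "Suc m * ln (Suc m) - Suc m + 1 \<le> ln (fact (Suc m))"
    by (intro ln_fact_ge) auto
  moreover have "ln (fact (Suc m)) = ln (Suc m) + ln (fact m :: real)"
    by (simp add: ln_mult)
  moreover have "ln (Suc m) \<le> ln (2 * real n)"
  proof -
    have "m \<le> n"
      by (simp add: m_def)
    then show ?thesis
      using assms by (subst ln_le_cancel_iff) auto
  qed
  moreover have "ln (2 * real n) \<le> ln n + 1"
    using assms ln_2_less_1 by (simp add: ln_mult)
  ultimately show ?thesis
    unfolding m_def by linarith
qed

section \<open>The summatory function of the von Mangoldt function\<close>

definition psi :: "nat \<Rightarrow> real" where
  "psi n = (\<Sum>d\<in>{1..n}. mangoldt d)"

lemma psi_diff: "m \<le> n \<Longrightarrow> psi n - psi m = (\<Sum>d\<in>{m<..n}. mangoldt d)"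
proof -
  assume "m \<le> n"
  then have "{1..n} = {1..m} \<union> {m<..n}" by auto
  then show ?thesis
    unfolding psi_def by (subst \<open>{1..n} = _\<close>, subst sum.union_disjoint) auto
qed

text \<open>From \<open>n\<close> to \<open>Suc n\<close> the quotient by \<open>d\<close> grows by
  1 exactly if \<open>d dvd Suc n\<close>, and the von Mangoldt function sums to
  \<open>ln (Suc n)\<close> over these divisors.\<close>

lemma ln_fact_eq_sum_mangoldt:
  "ln (fact n) = (\<Sum>d\<in>{1..n}. mangoldt d * real (n div d))"
proof (induction n)
  case (Suc n)
  have "(\<Sum>d\<in>{1..Suc n}. mangoldt d * real (Suc n div d)) =
        (\<Sum>d\<in>{1..Suc n}. mangoldt d * real (n div d) + (if d dvd Suc n then mangoldt d else 0))"
    by (intro sum.cong refl) (auto simp: div_Suc dvd_eq_mod_eq_0 algebra_simps)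
  also have "\<dots> = (\<Sum>d\<in>{1..Suc n}. mangoldt d * real (n div d)) +
                 (\<Sum>d\<in>{1..Suc n}. if d dvd Suc n then mangoldt d else 0)"
    by (rule sum.distrib)
  also have "(\<Sum>d\<in>{1..Suc n}. mangoldt d * real (n div d)) = ln (fact n)"
    using Suc.IH by simp
  also have "(\<Sum>d\<in>{1..Suc n}. if d dvd Suc n then mangoldt d else 0) = (\<Sum>d | d dvd Suc n. mangoldt d :: real)"
    by (intro sum.mono_neutral_cong_right) (auto dest: dvd_imp_le dvd_pos_nat[rotated] simp: Suc_le_eq)
  also have "\<dots> = ln (Suc n)"
    by (subst mangoldt_sum) auto
  finally show ?case
    by (simp add: ln_mult)
qed auto

lemma ln_fact_div_eq_sum_mangoldt:
  assumes "k \<ge> 1"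
  shows "ln (fact (n div k)) = (\<Sum>d\<in>{1..n}. mangoldt d * real (n div d div k))"
proof -
  have "ln (fact (n div k)) = (\<Sum>d\<in>{1..n div k}. mangoldt d * real (n div k div d))"
    by (rule ln_fact_eq_sum_mangoldt)
  also have "\<dots> = (\<Sum>d\<in>{1..n}. mangoldt d * real (n div k div d))"
    by (intro sum.mono_neutral_left) (auto intro: order.trans[OF _ div_le_dividend])
  also have "\<dots> = (\<Sum>d\<in>{1..n}. mangoldt d * real (n div d div k))"
    by (simp add: div_mult2_eq[symmetric] mult.commute)
  finally show ?thesis .
qed

section \<open>Chebyshev's weights\<close>

text \<open>The coefficient of \<open>mangoldt d\<close> in \<open>cheb_sum n\<close>, where
  \<open>N = n div d\<close>.\<close>

definition cheb_weight :: "nat \<Rightarrow> real" where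
  "cheb_weight N = real N - real (N div 2) - real (N div 3) - real (N div 5) + real (N div 30)"

text \<open>As 30 - 15 - 10 - 6 + 1 = 0, the weight has period 30, and the residues are checked one
  by one.\<close>

lemma cheb_weight_bounds: "cheb_weight N \<in> {0..1}"
proof -
  define q r where "q = N div 30" and "r = N mod 30"
  have N: "N = 30 * q + r" and "r < 30"
    by (auto simp: q_def r_def)
  have "(30 * q + r) div 2 = 15 * q + r div 2" "(30 * q + r) div 3 = 10 * q + r div 3"
       "(30 * q + r) div 5 = 6 * q + r div 5" "(30 * q + r) div 30 = q"
    using \<open>r < 30\<close> div_mult_self1[of 2 r "15 * q"] div_mult_self1[of 3 r "10 * q"]
      div_mult_self1[of 5 r "6 * q"] by (simp_all add: algebra_simps)
  then have eq: "cheb_weight N = real r - real (r div 2) - real (r div 3) - real (r div 5)"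
    unfolding cheb_weight_def N by simp
  have "list_all (\<lambda>r. real r - real (r div 2) - real (r div 3) - real (r div 5) \<in> {0..1}) [0..<30]"
    by (simp add: upt_conv_Cons)
  then show ?thesis
    unfolding eq using \<open>r < 30\<close> by (simp add: list_all_iff)
qed

lemma cheb_weight_eq_1: "1 \<le> N \<Longrightarrow> N < 6 \<Longrightarrow> cheb_weight N = 1"
proof -
  assume "1 \<le> N" "N < 6"
  then have "N \<in> {1,2,3,4,5}" by auto
  then show ?thesis
    by (auto simp: cheb_weight_def)
qed

definition cheb_sum :: "nat \<Rightarrow> real" where
  "cheb_sum n = ln (fact n) - ln (fact (n div 2)) - ln (fact (n div 3)) - ln (fact (n div 5))
      + ln (fact (n div 30))"

lemma cheb_sum_altdef: "cheb_sum n = (\<Sum>d\<in>{1..n}. mangoldt d * cheb_weight (n div d))"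
  unfolding cheb_sum_def cheb_weight_def
  by (subst ln_fact_eq_sum_mangoldt, (subst ln_fact_div_eq_sum_mangoldt, simp)+)
     (simp add: sum_subtractf sum.distrib algebra_simps)

lemma cheb_sum_le_psi: "cheb_sum n \<le> psi n"
  unfolding cheb_sum_altdef psi_def
  using cheb_weight_bounds by (intro sum_mono mult_left_le) (auto simp: mangoldt_nonneg)

text \<open>For \<open>d\<close> above \<open>n div 6\<close> the quotient \<open>n div d\<close> is
  between 1 and 5, where the weight is 1; the other terms are nonnegative.\<close>

lemma psi_le_cheb_sum: "psi n \<le> psi (n div 6) + cheb_sum n"
proof -
  have "psi n - psi (n div 6) = (\<Sum>d\<in>{n div 6<..n}. mangoldt d)"
    by (intro psi_diff) auto
  also have "\<dots> = (\<Sum>d\<in>{n div 6<..n}. mangoldt d * cheb_weight (n div d))"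
  proof (intro sum.cong refl)
    fix d assume d: "d \<in> {n div 6<..n}"
    then have "n < 6 * d" by (simp add: div_less_iff_less_mult mult.commute)
    then have "n div d < 6" using d by (simp add: div_less_iff_less_mult)
    moreover have "n div d \<ge> 1" using d by (simp add: Suc_le_eq div_greater_zero_iff)
    ultimately show "mangoldt d = mangoldt d * cheb_weight (n div d)"
      by (simp add: cheb_weight_eq_1)
  qed
  also have "\<dots> \<le> cheb_sum n"
    unfolding cheb_sum_altdef using cheb_weight_bounds
    by (intro sum_mono2) (auto intro!: mult_nonneg_nonneg simp: mangoldt_nonneg)
  finally show ?thesis by simp
qed

definition cheb_const :: real where
  "cheb_const = ln 2 / 2 + ln 3 / 3 + ln 5 / 5 - ln 30 / 30"

text \<open>As 1 - 1/2 - 1/3 - 1/5 + 1/30 = 0, the terms \<open>n * ln n\<close> and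
  \<open>n\<close> cancel, leaving \<open>cheb_const * n\<close>. Each of the five factorials costs
  \<open>ln n\<close>, and each use of \<open>ln_fact_div_le\<close> costs another 1: three times
  below, twice above.\<close>

lemma cheb_sum_bounds:
  assumes "n \<ge> 1"
  shows "cheb_const * n - 5 * ln n - 3 \<le> cheb_sum n" "cheb_sum n \<le> cheb_const * n + 5 * ln n + 2"
proof -
  have eq: "real n * ln n - n - (n / 2 * ln (n / 2) - n / 2) - (n / 3 * ln (n / 3) - n / 3)
     - (n / 5 * ln (n / 5) - n / 5) + (n / 30 * ln (n / 30) - n / 30) = cheb_const * n"
    using assms by (simp add: ln_div cheb_const_def field_simps)
  note le = ln_fact_div_le[OF assms] and ge = ln_fact_div_ge[OF assms]
  show "cheb_const * n - 5 * ln n - 3 \<le> cheb_sum n"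
    using ge[of 1] le[of 2] le[of 3] le[of 5] ge[of 30] eq by (simp add: cheb_sum_def)
  show "cheb_sum n \<le> cheb_const * n + 5 * ln n + 2"
    using le[of 1] ge[of 2] ge[of 3] ge[of 5] le[of 30] eq by (simp add: cheb_sum_def)
qed

section \<open>Numerical bounds for logarithms\<close>

lemma ln_2_bounds: "6931 / 10000 \<le> ln (2::real)" "ln (2::real) \<le> 6932 / 10000"
  using ln_approx_bounds[of 2 4] by (simp_all add: eval_nat_numeral)

lemma ln_le_by_powers:
  assumes "(a::real) ^ j \<le> b ^ k" "a > 0" "b > 0" "k > 0"
  shows "j / k * ln a \<le> ln b"
proof -
  have "ln (a ^ j) \<le> ln (b ^ k)"
    using assms by (subst ln_le_cancel_iff) auto
  then show ?thesis
    using assms by (simp add: ln_realpow field_simps)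
qed

text \<open>The exponents come from nearly equal powers: 2^19 < 3^12 and 3^5 < 2^8; below, 2^65 <
  5^28.\<close>

lemma ln_3_bounds: "19 / 12 * ln 2 \<le> ln (3::real)" "5 / 8 * ln 3 \<le> ln (2::real)"
  using ln_le_by_powers[of 2 19 3 12] ln_le_by_powers[of 3 5 2 8] by simp_all

lemma ln_5_ge: "65 / 28 * ln 2 \<le> ln (5::real)"
  using ln_le_by_powers[of 2 65 5 28] by simp

text \<open>Splitting \<open>ln 30\<close> turns the constant into (14 ln 2 + 9 ln 3 + 5 ln 5) / 30,
  so lower bounds suffice.\<close>

lemma cheb_const_ge: "cheb_const \<ge> 92 / 100"
proof -
  have "ln 30 = ln (2 * 3 * 5 :: real)"
    by simp
  also have "\<dots> = ln 2 + ln 3 + ln 5"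
    by (simp only: ln_mult) simp
  finally show ?thesis
    unfolding cheb_const_def using ln_2_bounds ln_3_bounds ln_5_ge by linarith
qed

text \<open>Iterating \<open>psi_le_cheb_sum\<close> gives a geometric series with sum 6/5 in the
  main term. The errors \<open>5 * ln n\<close> over about \<open>ln n / ln 6\<close> steps add up
  to about 5 / (2 ln 6) < 7/5 times the squared logarithm.\<close>

lemma psi_upper:
  "n \<ge> 1 \<Longrightarrow> psi n \<le> 6 / 5 * (cheb_const * n) + 7 / 5 * (ln n)\<^sup>2 + 37 / 10 * ln n + 2"
proof (induction n rule: less_induct)
  case (less n)
  define L where "L = ln (real n)"
  have "L \<ge> 0"
    using less.prems by (simp add: L_def)
  have step: "psi n \<le> psi (n div 6) + (cheb_const * n + 5 * L + 2)"
    using psi_le_cheb_sum[of n] cheb_sum_bounds(2)[OF less.prems] by (simp add: L_def)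
  show ?case
  proof (cases "n < 6")
    case True
    \<comment> \<open>This absorbs the excess of 5 over 37/10 in the coefficient of
      \<open>L\<close>; here \<open>n div 6 = 0\<close>.\<close>
    have "13 / 10 * L \<le> 7 / 5 * L\<^sup>2 + 1 / 5 * (cheb_const * n)"
    proof (cases "n = 1")
      case True
      then show ?thesis
        using cheb_const_ge by (simp add: L_def)
    next
      case False
      then have "2 * (92 / 100) \<le> n * cheb_const"
        using less.prems cheb_const_ge by (intro mult_mono) auto
      \<comment> \<open>Completing the square: 13/28 minimises
        \<open>7 / 5 * L\<^sup>2 - 13 / 10 * L\<close>, and the minimum exceeds -1/5 * 2 *
        92/100.\<close>
      moreover have "0 \<le> 7 / 5 * (L - 13 / 28)\<^sup>2"
        by simp
      ultimately show ?thesis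
        by (simp add: power2_eq_square algebra_simps)
    qed
    with True step show ?thesis
      by (simp add: psi_def L_def [symmetric])
  next
    case False
    define m where "m = n div 6"
    define a where "a = ln (6 :: real)"
    have m: "m \<ge> 1" "m < n" "real m \<le> n / 6"
      using False real_div_bounds(1)[of 6 n] by (auto simp: m_def)
    have "ln (6::real) = ln (2 * 3)"
      by simp
    also have "\<dots> = ln 2 + ln 3"
      by (simp only: ln_mult) simp
    finally have a: "179 / 100 \<le> a" "a \<le> 181 / 100"
      unfolding a_def using ln_2_bounds ln_3_bounds by simp_all
    have "ln m \<le> ln (n / 6)"
      using m by simp
    also have "\<dots> = L - a"
      using less.prems by (simp add: L_def a_def ln_div)
    finally have lm: "ln m \<le> L - a" .
    define D where "D = (L - a)\<^sup>2"
    have "(ln m)\<^sup>2 \<le> D"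
      unfolding D_def using lm m by (intro power_mono) auto
    moreover have "6 / 5 * (cheb_const * m) \<le> 1 / 5 * (cheb_const * n)"
      using mult_left_mono[OF m(3), of "6 / 5 * cheb_const"] cheb_const_ge by simp
    ultimately have "6 / 5 * (cheb_const * m) + 7 / 5 * (ln m)\<^sup>2 + 37 / 10 * ln m + 2 \<le>
        1 / 5 * (cheb_const * n) + 7 / 5 * D + 37 / 10 * L - 37 / 10 * a + 2"
      using lm by linarith
    with less.IH[OF m(2,1)] have "psi m \<le> 1 / 5 * (cheb_const * n) + 7 / 5 * D + 37 / 10 * L - 37 / 10 * a + 2"
      by (rule order.trans)
    moreover have "D = L\<^sup>2 - 2 * (a * L) + a\<^sup>2"
      by (simp add: D_def power2_eq_square algebra_simps)
    ultimately have "psi n \<le> 6 / 5 * (cheb_const * n) + 7 / 5 * L\<^sup>2 + 37 / 10 * L + 2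
                 + (5 * L - 14 / 5 * (a * L) + (7 / 5 * a\<^sup>2 - 37 / 10 * a + 2))"
      using step unfolding m_def[symmetric] by linarith
    moreover have "5 * L - 14 / 5 * (a * L) = (5 - 14 / 5 * a) * L"
      by (simp add: algebra_simps)
    moreover have "(5 - 14 / 5 * a) * L \<le> 0"
      using a \<open>L \<ge> 0\<close> by (intro mult_nonpos_nonneg) auto
    moreover have "7 / 5 * a\<^sup>2 - 37 / 10 * a + 2 \<le> 0"
    proof -
      \<comment> \<open>Since \<open>a\<close> lies between the two roots, this bounds its square by
        a linear expression.\<close>
      have "(a - 179 / 100) * (a - 181 / 100) \<le> 0"
        using a by (intro mult_nonneg_nonpos) auto
      then show ?thesis
        using a by (simp add: power2_eq_square algebra_simps)
    qed
    ultimately show ?thesis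
      by (simp add: L_def)
  qed
qed

section \<open>Primes between \<open>n\<close> and \<open>2 * n\<close> for large
  \<open>n\<close>\<close>

definition primes_from_to :: "nat \<Rightarrow> nat \<Rightarrow> nat set" where
  "primes_from_to a b = {p. prime p \<and> a \<le> p \<and> p < b}"

lemma finite_primes_from_to [simp]: "finite (primes_from_to a b)"
  by (rule finite_subset[of _ "{..<b}"]) (auto simp: primes_from_to_def)

text \<open>Each prime contributes at most \<open>ln (2 * n)\<close>. A proper prime power in the
  interval has base at most \<open>m\<close>, and each base occurs at most once because successive
  powers differ by a factor of at least 2; so proper powers contribute at most
  \<open>psi m\<close>.\<close>

lemma psi_diff_le:
  fixes n m :: nat
  assumes "n \<ge> 2" "2 * n < (Suc m)\<^sup>2"
  shows "psi (2 * n) - psi n \<le> card (primes_from_to n (2 * n)) * ln (2 * n) + psi m"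
proof -
  define A where "A = {p \<in> {n<..2*n}. prime p}"
  define B where "B = {d \<in> {n<..2*n}. primepow d \<and> \<not> prime d}"
  \<comment> \<open>The difference of \<open>psi\<close> includes the right endpoint, while the set
    of primes excludes it.\<close>
  have "\<not> prime (2 * n)"
    using assms prime_product[of 2 n] by auto
  then have A: "A \<subseteq> primes_from_to n (2 * n)"
    by (auto simp: A_def primes_from_to_def order.order_iff_strict)
  have B: "\<exists>k. prime (aprimedivisor d) \<and> k \<ge> 2 \<and> d = aprimedivisor d ^ k" if "d \<in> B" for d
  proof -
    obtain p k where pk: "prime p" "k > 0" "d = p ^ k"
      using \<open>d \<in> B\<close> by (auto simp: B_def primepow_def)
    moreover have "k \<noteq> 1"
      using pk \<open>d \<in> B\<close> by (auto simp: B_def)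
    ultimately show ?thesis
      by (intro exI[of _ k]) (auto simp: aprimedivisor_prime_power)
  qed
  have "psi (2 * n) - psi n = (\<Sum>d\<in>{n<..2*n}. mangoldt d)"
    by (intro psi_diff) auto
  also have "\<dots> = (\<Sum>d\<in>A \<union> B. mangoldt d)"
    by (intro sum.mono_neutral_right) (auto simp: A_def B_def mangoldt_def)
  also have "\<dots> = (\<Sum>d\<in>A. mangoldt d) + (\<Sum>d\<in>B. mangoldt d)"
    by (intro sum.union_disjoint) (auto simp: A_def B_def)
  also have "(\<Sum>d\<in>A. mangoldt d) \<le> card A * ln (2 * n)"
    by (intro sum_bounded_above) (auto simp: A_def prime_gt_0_nat)
  also have "card A * ln (2 * n) \<le> card (primes_from_to n (2 * n)) * ln (2 * n)"
    using assms A by (intro mult_right_mono) (auto intro!: card_mono)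
  also have "(\<Sum>d\<in>B. mangoldt d) = (\<Sum>d\<in>B. mangoldt (aprimedivisor d) :: real)"
  proof (intro sum.cong refl)
    fix d assume "d \<in> B"
    then show "mangoldt d = (mangoldt (aprimedivisor d) :: real)"
      using B[of d] by (simp add: B_def mangoldt_def)
  qed
  also have "\<dots> = (\<Sum>p\<in>aprimedivisor ` B. mangoldt p)"
  proof -
    have less: False if "p ^ j \<in> {n<..2*n}" "p ^ k \<in> {n<..2*n}" "prime p" "j < k" for p j k :: nat
    proof -
      have "2 * p ^ j \<le> p ^ Suc j"
        using prime_ge_2_nat[OF \<open>prime p\<close>] by simp
      also have "\<dots> \<le> p ^ k"
        using that prime_gt_0_nat by (intro power_increasing) (auto simp: Suc_le_eq)
      finally show False
        using that by simp
    qed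
    have "inj_on aprimedivisor B"
    proof (rule inj_onI)
      fix x y assume xy: "x \<in> B" "y \<in> B" "aprimedivisor x = aprimedivisor y"
      define p where "p = aprimedivisor x"
      obtain j where j: "x = p ^ j" "prime p"
        using B[OF xy(1)] unfolding p_def by blast
      obtain k where k: "y = p ^ k"
        using B[OF xy(2)] unfolding p_def xy(3) by blast
      have "x \<in> {n<..2*n}" "y \<in> {n<..2*n}"
        using xy by (auto simp: B_def)
      then have "j = k"
        unfolding j(1) k using less[of p j k] less[of p k j] j(2) by (meson linorder_neqE_nat)
      then show "x = y"
        using j k by simp
    qed
    then show ?thesis
      by (simp add: sum.reindex)
  qed
  also have "\<dots> \<le> psi m"
    unfolding psi_def
  proof (intro sum_mono2)
    show "aprimedivisor ` B \<subseteq> {1..m}"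
    proof safe
      fix d assume d: "d \<in> B"
      let ?p = "aprimedivisor d"
      obtain k where k: "prime ?p" "k \<ge> 2" "d = ?p ^ k"
        using B[OF d] by blast
      have "?p\<^sup>2 \<le> ?p ^ k"
        using k prime_gt_0_nat[of ?p] by (intro power_increasing) auto
      also have "\<dots> < (Suc m)\<^sup>2"
        using d k assms by (auto simp: B_def)
      finally have "?p < Suc m"
        by (rule power_less_imp_less_base) simp
      then show "?p \<in> {1..m}"
        using prime_gt_0_nat[OF k(1)] by auto
    qed
  qed (auto simp: mangoldt_nonneg)
  finally show ?thesis by simp
qed

text \<open>As 4096 = 2^12, \<open>ln (2 * n)\<close> is at most 13/12 times \<open>ln n\<close>, so
  it suffices to find \<open>13 / 20 * n\<close> on the side of \<open>psi\<close>. The main term is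
  at least 4/5 * 92/100 = 0.736 times \<open>n\<close>.\<close>

lemma card_primes_ge_large:
  assumes "n \<ge> 4096"
  shows "3 * real n / (5 * ln n) \<le> card (primes_from_to n (2 * n))"
proof -
  define L where "L = ln (real n)"
  define M where "M = ln (real (2 * n))"
  define m where "m = nat \<lfloor>sqrt (2 * n)\<rfloor>"
  define x where "x = sqrt n"
  have n: "real n = x\<^sup>2"
    by (simp add: x_def)
  have x: "x \<ge> 64"
    unfolding x_def using assms by (intro real_le_rsqrt) simp
  have "12 * ln 2 \<le> L"
  proof -
    have "ln (2 ^ 12) \<le> ln (real n)"
      using assms by (subst ln_le_cancel_iff) auto
    then show ?thesis
      by (simp only: L_def ln_realpow)
  qed
  moreover have "M = L + ln 2"
    using assms by (simp add: M_def L_def ln_mult)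
  ultimately have M: "M \<le> 13 / 12 * L" and L: "L > 0" and "M > 0"
    using ln_2_bounds by auto
  have L_le: "L \<le> 13 / 100 * x"
  proof -
    \<comment> \<open>Beyond \<open>exp 1\<close> the quotient \<open>ln x / x\<close> decreases, so
      its value at 64 bounds it.\<close>
    have "exp 1 \<le> (64::real)"
      using exp_le by simp
    then have "ln x / x \<le> ln 64 / 64"
      using x by (intro ln_x_over_x_mono) auto
    moreover have "ln (64::real) = 6 * ln 2"
      using ln_realpow[of 2 6] by simp
    ultimately have "ln x / x \<le> 13 / 200"
      using ln_2_bounds by linarith
    moreover have "L = 2 * ln x"
      unfolding L_def n using x by (simp add: ln_realpow)
    ultimately show ?thesis
      using x by (simp add: field_simps)
  qed
  have L2: "L\<^sup>2 \<le> 169 / 10000 * n"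
    using power_mono[OF L_le, of 2] L by (simp add: n power_mult_distrib power2_eq_square)
  have x_le: "x \<le> n / 64"
    using x by (simp add: n power2_eq_square)
  have "real m \<le> sqrt (2 * n)"
    by (simp add: m_def)
  also have "\<dots> = sqrt 2 * x"
    by (simp add: x_def real_sqrt_mult)
  also have "\<dots> \<le> 1415 / 1000 * x"
    using x by (intro mult_right_mono real_le_lsqrt) (auto simp: power2_eq_square)
  finally have m_le: "m \<le> 1415 / 1000 * x" .
  have "m \<ge> 1"
    using assms by (simp add: m_def Suc_le_eq)
  have "2 * n < (Suc m)\<^sup>2"
  proof -
    have "sqrt (2 * n) < Suc m"
      unfolding m_def by linarith
    then have "(sqrt (2 * n))\<^sup>2 < real (Suc m) ^ 2"
      by (intro power_strict_mono) auto
    then have "real (2 * n) < real ((Suc m)\<^sup>2)"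
      by simp
    then show ?thesis
      by (simp only: of_nat_less_iff)
  qed
  have "ln m \<le> ln (sqrt (2 * n))"
    using assms \<open>m \<ge> 1\<close> \<open>real m \<le> sqrt (2 * n)\<close> by (subst ln_le_cancel_iff) auto
  also have "\<dots> = M / 2"
    using assms by (simp add: M_def ln_sqrt)
  finally have ln_m: "ln m \<le> 13 / 24 * L"
    using M by simp
  have ln_m2: "(ln m)\<^sup>2 \<le> (13 / 24 * L)\<^sup>2"
    using ln_m \<open>m \<ge> 1\<close> by (intro power_mono) auto

  \<comment> \<open>The factor 4/5 is 2 - 6/5. The bracket is nonnegative, so the lower bound for
    \<open>cheb_const\<close> applies to it as a whole.\<close>
  have "92 / 100 * (4 / 5 * n - 6 / 5 * m) \<le> cheb_const * (4 / 5 * n - 6 / 5 * m)"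
    using cheb_const_ge m_le x_le by (intro mult_right_mono) auto
  moreover have "cheb_const * (2 * n) - 5 * M - 3 \<le> psi (2 * n)"
    using cheb_sum_bounds(1)[of "2 * n"] cheb_sum_le_psi[of "2 * n"] assms by (simp add: M_def)
  moreover have "psi n \<le> 6 / 5 * (cheb_const * n) + 7 / 5 * L\<^sup>2 + 37 / 10 * L + 2"
    using psi_upper[of n] assms by (simp add: L_def)
  moreover have "psi m \<le> 6 / 5 * (cheb_const * m) + 7 / 5 * (ln m)\<^sup>2 + 37 / 10 * ln m + 2"
    using psi_upper[of m] \<open>m \<ge> 1\<close> by simp
  moreover have "psi (2 * n) - psi n \<le> card (primes_from_to n (2 * n)) * M + psi m"
    using psi_diff_le[OF _ \<open>2 * n < _\<close>] assms by (simp add: M_def)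
  moreover have "real n \<ge> 4096"
    using assms by simp
  ultimately have "13 / 20 * n \<le> card (primes_from_to n (2 * n)) * M"
    using L_le L2 x_le m_le ln_m ln_m2 M
    by (simp add: power_mult_distrib power2_eq_square algebra_simps)
  moreover have "3 * real n / (5 * L) * M \<le> 3 * real n / (5 * L) * (13 / 12 * L)"
    using M L by (intro mult_left_mono) auto
  moreover have "3 * real n / (5 * L) * (13 / 12 * L) = 13 / 20 * n"
    using L by (simp add: field_simps)
  ultimately have "3 * real n / (5 * L) * M \<le> card (primes_from_to n (2 * n)) * M"
    by linarith
  then show ?thesis
    using \<open>M > 0\<close> unfolding L_def by (simp only: mult_le_cancel_right_pos)
qed

section \<open>Counting small primes\<close>

text \<open>Counting is done over type int because its code equations compute with binary numerals,
  whereas those of type nat would be evaluated in unary.\<close>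

fun trial_division :: "int list \<Rightarrow> int \<Rightarrow> bool" where
  "trial_division [] n = True"
| "trial_division (d # ds) n =
     (if n < d * d then True else if n mod d = 0 then False else trial_division ds n)"

text \<open>All primes below 91; they decide primality below 91^2 = 8281.\<close>

definition small_primes :: "int list" where
  "small_primes = [2, 3, 5, 7, 11, 13, 17, 19, 23, 29, 31, 37, 41, 43, 47, 53, 59, 61, 67, 71, 73,
     79, 83, 89]"

text \<open>Sortedness justifies the early exit: later entries have larger squares.\<close>

lemma trial_divisionD:
  "trial_division ds n \<Longrightarrow> sorted ds \<Longrightarrow> \<forall>d\<in>set ds. d \<ge> 0 \<Longrightarrow> d \<in> set ds \<Longrightarrow> d dvd n \<Longrightarrow> n < d * d"
proof (induction ds)
  case (Cons e ds)
  have "e * e \<le> d * d"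
    using Cons.prems by (intro mult_mono) auto
  with Cons show ?case
    by (auto split: if_splits)
qed auto

text \<open>The only entry that can divide a prime \<open>n\<close> is \<open>n\<close> itself, and
  there the square test already succeeds.\<close>

lemma trial_division_prime:
  "prime n \<Longrightarrow> \<forall>d\<in>set ds. d \<ge> 2 \<Longrightarrow> trial_division ds n"
proof (induction ds)
  case (Cons d ds)
  have "n < d * d" if "n mod d = 0"
  proof -
    have "d dvd n" "d \<ge> 2"
      using that Cons.prems by auto
    then have "d = n"
      using Cons.prems(1) prime_int_not_dvd[of n d] zdvd_imp_le[of d n] prime_gt_0_int[of n] by force
    moreover have "d * 1 < d * d"
      using Cons.prems by (intro mult_strict_left_mono) auto
    ultimately show ?thesis
      by simp
  qed
  with Cons show ?case
    by auto
qed auto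

lemma prime_in_small_primes:
  assumes "prime p" "p < 91"
  shows "p \<in> set small_primes"
proof -
  \<comment> \<open>A composite number below 91 < 11^2 has a prime factor among 2, 3, 5, 7.\<close>
  have "list_all (\<lambda>p. p \<in> set small_primes \<or>
          (\<exists>d\<in>set [2,3,5,7]. d \<noteq> p \<and> p mod d = 0)) [2..90]"
    by code_simp
  moreover have "p \<in> {2..90}"
    using assms prime_ge_2_int[of p] by simp
  ultimately have "p \<in> set small_primes \<or> (\<exists>d\<in>{2,3,5,7}. d \<noteq> p \<and> p mod d = 0)"
    unfolding list_all_iff set_upto by simp
  then consider "p \<in> set small_primes" | d where "d \<in> {2,3,5,7}" "d \<noteq> p" "d dvd p"
    using mod_0_imp_dvd by blast
  then show ?thesis
  proof cases
    case 2
    then have "d > 1" "d < p"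
      using assms prime_gt_0_int[of p] zdvd_imp_le[of d p] by auto
    then show ?thesis
      using 2 assms prime_int_not_dvd[of p d] by simp
  qed
qed

lemma trial_division_iff_prime:
  assumes "2 \<le> n" "n < 8281"
  shows "trial_division small_primes n \<longleftrightarrow> prime n"
proof
  assume trial: "trial_division small_primes n"
  show "prime n"
  proof (rule ccontr)
    assume "\<not> prime n"
    then have "\<not> prime (nat n)"
      using assms by simp
    then obtain q :: nat where q: "prime q" "q dvd nat n" "q\<^sup>2 \<le> nat n"
      using assms prime_prime_factor_sqrt[of "nat n"] by auto
    define p where "p = int q"
    have p: "prime p" "p dvd n" "p\<^sup>2 \<le> n"
      using q assms by (simp_all add: p_def int_dvd_int_iff[symmetric] le_nat_iff)
    have "p < 91"
    proof (rule ccontr)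
      assume "\<not> p < 91"
      then have "91\<^sup>2 \<le> p\<^sup>2"
        by (intro power_mono) auto
      with p assms show False
        by simp
    qed
    then have "p \<in> set small_primes"
      using p by (intro prime_in_small_primes)
    then have "n < p * p"
      using trial p by (intro trial_divisionD[of small_primes]) (auto simp: small_primes_def)
    with p show False
      by (simp add: power2_eq_square)
  qed
next
  assume "prime n"
  then show "trial_division small_primes n"
    by (intro trial_division_prime) (auto simp: small_primes_def)
qed

section \<open>Tables of the prime-counting function\<close>

definition prime_count :: "int \<Rightarrow> int" where
  "prime_count x = int (card {p::int. prime p \<and> p < x})"

lemma finite_primes_less [simp]: "finite {p::int. prime p \<and> p < x}"
  by (rule finite_subset[of _ "{0..x}"]) (auto intro: prime_ge_0_int)

lemma prime_count_diff:
  assumes "a \<le> b"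
  shows "prime_count b - prime_count a = int (card {p. prime p \<and> a \<le> p \<and> p < b})"
proof -
  have "{p. prime p \<and> p < b} = {p. prime p \<and> p < a} \<union> {p. prime p \<and> a \<le> p \<and> p < b}"
    using assms by auto
  moreover have "finite {p. prime p \<and> a \<le> p \<and> p < b}"
    by (rule finite_subset[OF _ finite_primes_less[of b]]) auto
  then have "card ({p. prime p \<and> p < a} \<union> {p. prime p \<and> a \<le> p \<and> p < b}) =
      card {p. prime p \<and> p < a} + card {p. prime p \<and> a \<le> p \<and> p < b}"
    by (intro card_Un_disjoint) auto
  ultimately show ?thesis
    by (simp add: prime_count_def)
qed

text \<open>The running count \<open>c\<close> of primes below \<open>a\<close> is carried along, so
  each segment is searched once.\<close>

fun check_prime_counts :: "int \<Rightarrow> int \<Rightarrow> (int \<times> int) list \<Rightarrow> bool" where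
  "check_prime_counts a c [] = True"
| "check_prime_counts a c ((b, v) # t) =
     (a \<le> b \<and> b \<le> 8281 \<and> c + int (length (filter (trial_division small_primes) [a..b - 1])) = v
       \<and> check_prime_counts b v t)"

lemma check_prime_counts_correct:
  "check_prime_counts a c t \<Longrightarrow> 2 \<le> a \<Longrightarrow> prime_count a = c \<Longrightarrow>
     (\<forall>(b, v)\<in>set t. prime_count b = v)"
proof (induction a c t rule: check_prime_counts.induct)
  case (2 a c b v t)
  have "length (filter (trial_division small_primes) [a..b - 1]) =
      card ({p. trial_division small_primes p} \<inter> {a..b - 1})"
    by (simp add: distinct_length_filter)
  also have "{p. trial_division small_primes p} \<inter> {a..b - 1} = {p. prime p \<and> a \<le> p \<and> p < b}"
    using 2(2,3) by (auto simp: trial_division_iff_prime)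
  finally have "prime_count b = v"
    using 2(2,4) prime_count_diff[of a b] by simp
  with 2 show ?case
    by auto
qed auto

lemma prime_count_2: "prime_count 2 = 0"
proof -
  have "{p::int. prime p \<and> p < 2} = {}"
    by (auto dest: prime_ge_2_int)
  then show ?thesis
    unfolding prime_count_def by simp
qed

text \<open>The arguments are breakpoints of the block decomposition below and doubles of
  breakpoints. Each later table continues from the last entry of the one before.\<close>

lemma prime_counts_1:
  "\<forall>(b, v)\<in>set
    [(22, 8), (24, 9), (29, 9), (31, 10), (37, 11), (43, 13), (44, 14), (48, 15), (53, 15),
      (58, 16), (61, 17), (62, 18), (64, 18), (72, 20), (74, 21), (81, 22), (86, 23), (91, 24),
      (96, 24), (102, 26), (106, 27), (114, 30), (122, 30), (128, 31), (144, 34), (162, 37),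
      (182, 42), (204, 46), (228, 49), (256, 54), (288, 61), (324, 66), (364, 72), (408, 79),
      (456, 87), (512, 97), (576, 105), (648, 118), (728, 129), (816, 141), (912, 156),
      (1024, 172), (1152, 190), (1296, 210), (1456, 231), (1632, 258), (1824, 281),
      (2048, 309), (2304, 342), (2592, 377)].
    prime_count b = v"
proof (rule check_prime_counts_correct[of 2 0], goal_cases)
  case 1
  show ?case by code_simp
next
  case 3
  show ?case using prime_count_2 by simp
qed simp

lemma prime_counts_2:
  "\<forall>(b, v)\<in>set
    [(2912, 421), (3264, 461), (3648, 510), (4096, 564), (4608, 623)].
    prime_count b = v"
proof (rule check_prime_counts_correct[of 2592 377], goal_cases)
  case 1
  show ?case by code_simp
next
  case 3
  show ?case using prime_counts_1 by simp
qed simp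

lemma prime_counts_3:
  "\<forall>(b, v)\<in>set
    [(5184, 690), (5824, 764), (6528, 843)].
    prime_count b = v"
proof (rule check_prime_counts_correct[of 4608 623], goal_cases)
  case 1
  show ?case by code_simp
next
  case 3
  show ?case using prime_counts_2 by simp
qed simp

lemma prime_counts_4:
  "\<forall>(b, v)\<in>set
    [(7296, 929)].
    prime_count b = v"
proof (rule check_prime_counts_correct[of 6528 843], goal_cases)
  case 1
  show ?case by code_simp
next
  case 3
  show ?case using prime_counts_3 by simp
qed simp

lemmas prime_counts =
  prime_counts_1[simplified] prime_counts_2[simplified]
  prime_counts_3[simplified] prime_counts_4[simplified]

section \<open>The prime bound on blocks of small \<open>n\<close>\<close>

text \<open>All \<open>n\<close> in the block share the primes from \<open>b\<close> to below
  \<open>2 * a\<close>. As \<open>ln n \<ge> ln a \<ge> k / 4 * ln 2 \<ge> 6931 * k / 40000\<close>,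
  the claim reduces to the integer inequality \<open>count\<close>.\<close>

lemma card_primes_ge_block:
  fixes n a b k :: nat
  assumes n: "a \<le> n" "n \<le> b" and a: "2 \<le> a" "b \<le> 2 * a" "2 ^ k \<le> a ^ 4" "k > 0"
    and count: "24000 * int b \<le> (prime_count (2 * int a) - prime_count (int b)) * (6931 * int k)"
  shows "3 * real n / (5 * ln n) \<le> card (primes_from_to n (2 * n))"
proof -
  define c where "c = card {p::int. prime p \<and> int b \<le> p \<and> p < 2 * int a}"
  have "c \<le> card (primes_from_to n (2 * n))"
  proof -
    have "c = card (nat ` {p::int. prime p \<and> int b \<le> p \<and> p < 2 * int a})"
      unfolding c_def by (intro card_image[symmetric] inj_onI) (auto dest: prime_ge_0_int)
    also have "\<dots> \<le> card (primes_from_to n (2 * n))"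
      using n by (intro card_mono) (auto simp: primes_from_to_def)
    finally show ?thesis .
  qed
  have "2 ^ k \<le> real a ^ 4"
    using a(3) by (metis of_nat_le_iff of_nat_numeral of_nat_power)
  then have "k / 4 * ln 2 \<le> ln a"
    using ln_le_by_powers[of 2 k "real a" 4] a by simp
  moreover have "k / 4 * (6931 / 10000) \<le> k / 4 * ln 2"
    using ln_2_bounds by (intro mult_left_mono) auto
  ultimately have ln_a: "k * 6931 / 40000 \<le> ln a"
    by simp
  have ln_n: "ln a \<le> ln n" "ln a > 0"
    using n a by auto
  have "24000 * int b \<le> int c * (6931 * int k)"
    using count prime_count_diff[of b "2 * a"] a by (simp add: c_def)
  then have "real_of_int (24000 * int b) \<le> real_of_int (int c * (6931 * int k))"
    by (simp only: of_int_le_iff)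
  then have "3 * real b \<le> 5 * (real c * (k * 6931 / 40000))"
    by simp
  also have "\<dots> \<le> 5 * (card (primes_from_to n (2 * n)) * ln n)"
    using ln_a ln_n \<open>c \<le> _\<close> by (intro mult_left_mono mult_mono) auto
  finally have "3 * real n \<le> card (primes_from_to n (2 * n)) * (5 * ln n)"
    using n by simp
  then show ?thesis
    using ln_n by (simp add: divide_le_eq)
qed

text \<open>In a list \<open>(b\<^sub>1, k\<^sub>1), (b\<^sub>2, k\<^sub>2), \<dots>\<close> the \<open>b\<^sub>i\<close> are successive breakpoints, and
  \<open>k\<^sub>i / 4\<close> is a lower bound for the binary logarithm of the preceding breakpoint.\<close>

fun check_blocks :: "nat \<Rightarrow> (nat \<times> nat) list \<Rightarrow> bool" where
  "check_blocks a [] = True"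
| "check_blocks a ((b, k) # t) =
     (2 \<le> a \<and> b \<le> 2 * a \<and> 2 ^ k \<le> a ^ 4 \<and> k > 0 \<and>
      24000 * int b \<le> (prime_count (2 * int a) - prime_count (int b)) * (6931 * int k) \<and>
      check_blocks b t)"

lemma check_blocks_correct:
  "check_blocks a t \<Longrightarrow> a \<le> n \<Longrightarrow> n < last (a # map fst t) \<Longrightarrow>
     3 * real n / (5 * ln n) \<le> card (primes_from_to n (2 * n))"
proof (induction a t rule: check_blocks.induct)
  case (2 a b k t)
  show ?case
  proof (cases "n \<le> b")
    case True
    then show ?thesis
      using 2 by (intro card_primes_ge_block[of a n b k]) auto
  next
    case False
    then show ?thesis
      using 2 by (intro "2.IH") auto
  qed
qed auto

lemma card_primes_ge_small:
  assumes "22 \<le> n" "n < 4096"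
  shows "3 * real n / (5 * ln n) \<le> card (primes_from_to n (2 * n))"
proof (rule check_blocks_correct)
  \<comment> \<open>From 64 on the breakpoints grow by a factor of about 9/8 and double every six
    steps, so that doubles are mostly breakpoints again.\<close>
  show "check_blocks 22
      [(24, 17), (29, 18), (31, 19), (37, 19), (43, 20), (48, 21), (53, 22), (61, 22),
       (64, 23), (72, 24), (81, 24), (91, 25), (102, 26), (114, 26), (128, 27), (144, 28),
       (162, 28), (182, 29), (204, 30), (228, 30), (256, 31), (288, 32), (324, 32), (364, 33),
       (408, 34), (456, 34), (512, 35), (576, 36), (648, 36), (728, 37), (816, 38), (912, 38),
       (1024, 39), (1152, 40), (1296, 40), (1456, 41), (1632, 42), (1824, 42), (2048, 43),
       (2304, 44), (2592, 44), (2912, 45), (3264, 46), (3648, 46), (4096, 47)]"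
    by (simp add: prime_counts)
qed (use assms in simp_all)

lemma card_primes_ge:
  assumes "n > 21"
  shows "3 * real n / (5 * ln n) \<le> card (primes_from_to n (2 * n))"
  using assms card_primes_ge_small[of n] card_primes_ge_large[of n] by (cases "n < 4096") auto

section \<open>The primes \<open>S q\<close>\<close>

text \<open>A prime divisor \<open>p\<close> of the Mersenne number \<open>2 ^ q - 1\<close> is congruent to 1 modulo \<open>q\<close>,
  because 2 has order \<open>q\<close> modulo \<open>p\<close>. Hence no appeal to Dirichlet's theorem is needed.\<close>

lemma ex_prime_cong_1:
  fixes q :: nat
  assumes "prime q"
  shows "\<exists>p. prime p \<and> q dvd p - 1"
proof -
  have "q \<ge> 2"
    using assms by (rule prime_ge_2_nat)
  then have "2 ^ 2 \<le> (2 ^ q :: nat)"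
    by (intro power_increasing) auto
  then have "2 ^ q - 1 \<noteq> (1::nat)"
    by simp
  then obtain p :: nat where p: "prime p" "p dvd 2 ^ q - 1"
    using prime_factor_nat by blast
  then have "[2 ^ q = 1] (mod p)"
    by (simp add: cong_altdef_nat)
  then have "ord p 2 dvd q"
    by (simp only: ord_divides)
  then have "ord p 2 = 1 \<or> ord p 2 = q"
    using assms by (simp add: prime_nat_iff)
  moreover have "ord p 2 \<noteq> 1"
  proof
    assume "ord p 2 = 1"
    then have "[2 = 1] (mod p)"
      using ord[of 2 p] by simp
    then have "p dvd 1"
      by (simp add: cong_altdef_nat)
    then show False
      using p by auto
  qed
  ultimately have "ord p 2 = q"
    by blast
  \<comment> \<open>\<open>ord\<close> takes the default value 0 on arguments that are not
    coprime.\<close>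
  then have "coprime p 2"
    using \<open>q \<ge> 2\<close> ord_eq_0[of p 2] by auto
  then have "ord p 2 dvd totient p"
    using order_divides_totient[of p 2] by simp
  then show ?thesis
    using p \<open>ord p 2 = q\<close> by (auto simp: totient_prime)
qed

lemma
  assumes "prime q"
  shows prime_S: "prime (S q)" and dvd_S_minus_1: "q dvd S q - 1"
  unfolding S_def using LeastI_ex[OF ex_prime_cong_1[OF assms]] by auto

lemma inj_on_S_Qset: "inj_on S (Qset \<mu> s)"
proof -
  have neq: "S q \<noteq> S r" if "q \<in> Qset \<mu> s" "r \<in> Qset \<mu> s" "q < r" for q r
  proof
    assume eq: "S q = S r"
    have qr: "prime q" "prime r"
      using that by (auto simp: Qset_def)
    have "q * r dvd S q - 1"
      using qr \<open>q < r\<close> dvd_S_minus_1[of q] dvd_S_minus_1[of r] eq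
      by (intro divides_mult primes_coprime) auto
    moreover have "S q > 1"
      using prime_S[OF qr(1)] prime_gt_1_nat by blast
    ultimately have "q * r < S q"
      by (auto dest!: dvd_imp_le)
    moreover have "q * q \<le> q * r"
      using \<open>q < r\<close> by simp
    ultimately have "q * q < S q"
      by linarith
    then have "real q * real q < real (S q)"
      by (metis of_nat_less_iff of_nat_mult)
    also have "\<dots> < real q powr 1.89"
      using that by (simp add: Qset_def)
    also have "\<dots> \<le> real q powr 2"
      using prime_gt_0_nat[OF qr(1)] by (intro powr_mono) auto
    also have "\<dots> = real q * real q"
      using prime_gt_0_nat[OF qr(1)] by (simp add: power2_eq_square)
    finally show False by simp
  qed
  show ?thesis
    by (rule inj_onI) (metis neq linorder_neqE_nat)
qed

section \<open>The size of \<open>Qset\<close> and the useful primes\<close>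

text \<open>The least \<open>n\<close> exists because \<open>x / ln x\<close> dominates
  \<open>x / (ln x)\<^sup>2\<close>, so \<open>Upsilon \<mu>\<close> is unbounded.\<close>

lemma nmin_properties:
  "nmin \<mu> s > 21" "real (nmin \<mu> s) > \<mu>" "Upsilon \<mu> (nmin \<mu> s) > real s"
proof -
  have "filterlim (\<lambda>n::nat. Upsilon \<mu> (real n)) at_top sequentially"
    unfolding Upsilon_def by real_asymp
  then have "eventually (\<lambda>n::nat. Upsilon \<mu> (real n) > s) sequentially"
    by (simp add: filterlim_at_top_dense)
  moreover have "eventually (\<lambda>n::nat. real n > \<mu>) sequentially"
    by real_asymp
  ultimately have "eventually (\<lambda>n::nat. n > 21 \<and> real n > \<mu> \<and> Upsilon \<mu> (real n) > s) sequentially"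
    using eventually_gt_at_top[of 21] by eventually_elim auto
  then have "\<exists>n::nat. n > 21 \<and> real n > \<mu> \<and> Upsilon \<mu> (real n) > s"
    by (rule eventually_happens'[OF sequentially_bot])
  from LeastI_ex[OF this]
  show "nmin \<mu> s > 21" "real (nmin \<mu> s) > \<mu>" "Upsilon \<mu> (nmin \<mu> s) > real s"
    unfolding nmin_def by auto
qed

lemma finite_Qset [simp]: "finite (Qset \<mu> s)"
  by (rule finite_subset[of _ "{..<2 * nmin \<mu> s}"]) (auto simp: Qset_def)

text \<open>Every prime counted by \<open>card_primes_ge\<close> is in \<open>Qset\<close> or
  exceptional; subtracting the exceptions leaves more than \<open>Upsilon \<mu> n\<close>.\<close>

lemma card_Qset_ge:
  assumes "\<And>n::nat. real n > \<mu> \<Longrightarrow>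
    real (card {q \<in> {n..2*n}. \<not> (real (S q) < real q powr 1.89)}) < \<mu> * real n / (ln (real n))\<^sup>2"
  shows "s \<le> card (Qset \<mu> s)"
proof -
  define n where "n = nmin \<mu> s"
  define E where "E = {q \<in> {n..2*n}. \<not> (real (S q) < real q powr 1.89)}"
  have n: "n > 21" "real n > \<mu>" "Upsilon \<mu> n > s"
    unfolding n_def by (rule nmin_properties)+
  have "finite E"
    by (simp add: E_def)
  have "3 * real n / (5 * ln n) \<le> card (primes_from_to n (2 * n))"
    using n(1) by (rule card_primes_ge)
  also have "card (primes_from_to n (2 * n)) \<le> card (Qset \<mu> s \<union> E)"
    using \<open>finite E\<close>
    by (intro of_nat_mono card_mono) (auto simp: primes_from_to_def Qset_def E_def n_def)
  also have "\<dots> \<le> card (Qset \<mu> s) + card E"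
    by (intro of_nat_mono card_Un_le)
  finally have "3 * real n / (5 * ln n) \<le> real (card (Qset \<mu> s)) + card E"
    by simp
  moreover have "card E < \<mu> * n / (ln n)\<^sup>2"
    unfolding E_def by (rule assms) fact
  ultimately have "real s < card (Qset \<mu> s)"
    using n(3) by (simp add: Upsilon_def)
  then show ?thesis
    by simp
qed

text \<open>Each distinct prime factor contributes at least 2 to the factorization of
  \<open>C\<close>.\<close>

lemma card_prime_divisors_le_log:
  assumes "C > (0::nat)" "log 2 C \<le> real b" "\<And>p. p \<in> A \<Longrightarrow> prime p \<and> p dvd C"
  shows "finite A" "card A \<le> b"
proof -
  have sub: "A \<subseteq> prime_factors C"
    using assms by (auto simp: prime_factors_dvd)
  then show "finite A"
    by (rule finite_subset) auto
  have "(2::nat) ^ card (prime_factors C) = (\<Prod>p\<in>prime_factors C. 2)"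
    by simp
  also have "\<dots> \<le> (\<Prod>p\<in>prime_factors C. p ^ multiplicity p C)"
  proof (intro prod_mono conjI)
    fix p assume p: "p \<in> prime_factors C"
    then have "2 \<le> p"
      by (intro prime_ge_2_nat) auto
    also have "p ^ 1 \<le> p ^ multiplicity p C"
      using p \<open>2 \<le> p\<close> by (intro power_increasing) (auto simp: prime_factors_multiplicity)
    finally show "2 \<le> p ^ multiplicity p C"
      by simp
  qed auto
  also have "\<dots> = C"
    using assms by (intro prime_factorization_nat[symmetric]) auto
  finally have "2 ^ card (prime_factors C) \<le> real C"
    by (metis of_nat_le_iff of_nat_numeral of_nat_power)
  then have "card (prime_factors C) \<le> log 2 C"
    using assms(1) by (simp add: le_log_iff powr_realpow)
  then have "card (prime_factors C) \<le> b"
    using assms(2) by simp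
  then show "card A \<le> b"
    using card_mono[OF _ sub] by simp
qed

lemma card_useful_ge:
  assumes "C1 > 0" "C2 > 0" "log 2 C1 \<le> real b1" "log 2 C2 \<le> real b2"
    and card: "b1 + b2 + l \<le> card (Qset \<mu> s)"
  shows "l \<le> card {p \<in> Pset \<mu> s. useful C1 C2 p}"
proof -
  define U where "U = {p \<in> Pset \<mu> s. useful C1 C2 p}"
  define A1 where "A1 = {p. prime p \<and> p dvd C1}"
  define A2 where "A2 = {q. prime q \<and> q dvd C2}"
  have "finite U"
    by (simp add: U_def Pset_def)
  have A1: "finite A1" "card A1 \<le> b1"
    using card_prime_divisors_le_log[of C1 b1 A1] assms by (auto simp: A1_def)
  have A2: "finite A2" "card A2 \<le> b2"
    using card_prime_divisors_le_log[of C2 b2 A2] assms by (auto simp: A2_def)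
  have "Pset \<mu> s \<subseteq> U \<union> A1 \<union> S ` A2"
  proof
    fix p assume "p \<in> Pset \<mu> s"
    then obtain q where q: "prime q" "p = S q"
      by (auto simp: Pset_def Qset_def)
    have "q \<in> A2" if "(p - 1) dvd C2"
      using q that dvd_S_minus_1[OF q(1)] by (auto simp: A2_def intro: dvd_trans)
    then show "p \<in> U \<union> A1 \<union> S ` A2"
      using \<open>p \<in> Pset \<mu> s\<close> q prime_S[OF q(1)] by (auto simp: U_def A1_def useful_def)
  qed
  then have "card (Pset \<mu> s) \<le> card (U \<union> A1 \<union> S ` A2)"
    using \<open>finite U\<close> A1 A2 by (intro card_mono) auto
  also have "\<dots> \<le> card U + card A1 + card (S ` A2)"
    using card_Un_le[of "U \<union> A1" "S ` A2"] card_Un_le[of U A1] by linarith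
  also have "card (S ` A2) \<le> card A2"
    using A2 by (intro card_image_le)
  finally have "card (Pset \<mu> s) \<le> card U + b1 + b2"
    using A1 A2 by linarith
  moreover have "card (Pset \<mu> s) = card (Qset \<mu> s)"
    unfolding Pset_def by (intro card_image inj_on_S_Qset)
  ultimately show ?thesis
    using card by (simp add: U_def)
qed

section \<open>Growth of \<open>nmin\<close> and the final bounds\<close>

text \<open>Eventually \<open>Upsilon \<mu> x \<ge> x / (2 * ln x)\<close>, as 1/2 < 3/5. At
  \<open>x = 3 * (s * ln s)\<close> this is about \<open>3 / 2 * s\<close>, hence above
  \<open>s\<close>; the factor 4 leaves room for rounding up.\<close>

lemma nmin_le_eventually:
  "\<exists>N>1. \<forall>s::nat. real s \<ge> N \<longrightarrow> real (nmin \<mu> s) \<le> 4 * (real s * ln s)"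
proof -
  have "eventually (\<lambda>x. Upsilon \<mu> x \<ge> x / (2 * ln x)) at_top"
    unfolding Upsilon_def by real_asymp
  then obtain X where X: "\<And>x. x \<ge> X \<Longrightarrow> Upsilon \<mu> x \<ge> x / (2 * ln x)"
    by (auto simp: eventually_at_top_linorder)
  have "filterlim (\<lambda>s::real. 3 * (s * ln s)) at_top at_top"
    by real_asymp
  then have "eventually (\<lambda>s. 3 * (s * ln s) \<ge> max X (max 22 (\<mu> + 1))) at_top"
    by (simp only: filterlim_at_top)
  moreover have "eventually (\<lambda>s::real. s * ln s \<ge> 1) at_top"
    by real_asymp
  moreover have "eventually (\<lambda>s::real. 3 * (s * ln s) / (2 * ln (4 * (s * ln s))) > s) at_top"
    by real_asymp
  ultimately have "eventually (\<lambda>s. 3 * (s * ln s) \<ge> max X (max 22 (\<mu> + 1)) \<and> s * ln s \<ge> 1 \<and>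
      3 * (s * ln s) / (2 * ln (4 * (s * ln s))) > s) at_top"
    by eventually_elim simp
  then obtain N where N: "\<And>s. s \<ge> N \<Longrightarrow> 3 * (s * ln s) \<ge> max X (max 22 (\<mu> + 1)) \<and> s * ln s \<ge> 1 \<and>
      3 * (s * ln s) / (2 * ln (4 * (s * ln s))) > s"
    by (auto simp: eventually_at_top_linorder)
  have "real (nmin \<mu> s) \<le> 4 * (real s * ln s)" if "real s \<ge> max N 2" for s
  proof -
    define y where "y = real s * ln s"
    define m where "m = nat \<lceil>3 * y\<rceil>"
    have y: "3 * y \<ge> X" "3 * y \<ge> 22" "3 * y \<ge> \<mu> + 1" "y \<ge> 1" "3 * y / (2 * ln (4 * y)) > s"
      using N[of s] that by (auto simp: y_def)
    have m: "3 * y \<le> m" "m \<le> 4 * y"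
      using y unfolding m_def by linarith+
    have "3 * y / (2 * ln (4 * y)) \<le> m / (2 * ln m)"
      using y m by (intro frac_le) auto
    also have "\<dots> \<le> Upsilon \<mu> m"
      using y m by (intro X) auto
    finally have "nmin \<mu> s \<le> m"
      unfolding nmin_def using y m by (intro Least_le) auto
    then show ?thesis
      using m by (simp add: y_def)
  qed
  then show ?thesis
    by (intro exI[of _ "max N 2"]) auto
qed

theorem mainTheorem4:
  fixes \<mu> :: real
  assumes mu_pos: "\<mu> > 0"
    and mu_hyp: "\<And>n::nat. real n > \<mu> \<Longrightarrow>
          real (card {q \<in> {n..2*n}. \<not> (real (S q) < real q powr 1.89)}) < \<mu> * real n / (ln (real n))\<^sup>2"
  shows "(\<forall>C1 C2 \<beta>1 \<beta>2 l :: nat.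
            C1 > 0 \<longrightarrow> C2 > 0 \<longrightarrow> log 2 (real C1) \<le> real \<beta>1 \<longrightarrow> log 2 (real C2) \<le> real \<beta>2 \<longrightarrow>
              card {p \<in> Pset \<mu> (\<beta>1 + \<beta>2 + l). prime p} \<ge> \<beta>1 + \<beta>2 + l
            \<and> card {p \<in> Pset \<mu> (\<beta>1 + \<beta>2 + l). useful C1 C2 p} \<ge> l)
       \<and> (\<exists>K N :: real. \<forall>C1 C2 \<beta>1 \<beta>2 l :: nat.
            C1 > 0 \<longrightarrow> C2 > 0 \<longrightarrow> log 2 (real C1) \<le> real \<beta>1 \<longrightarrow> log 2 (real C2) \<le> real \<beta>2 \<longrightarrow>
            real (\<beta>1 + \<beta>2 + l) \<ge> N \<longrightarrow>
            (\<forall>p \<in> Pset \<mu> (\<beta>1 + \<beta>2 + l).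
               real p \<le> K * real (\<beta>1 + \<beta>2 + l) powr 1.89 * ln (real (\<beta>1 + \<beta>2 + l)) powr 1.89))"
proof (intro conjI allI impI)
  fix C1 C2 b1 b2 l :: nat
  assume C: "C1 > 0" "C2 > 0" "log 2 C1 \<le> real b1" "log 2 C2 \<le> real b2"
  define s where "s = b1 + b2 + l"
  have card: "s \<le> card (Qset \<mu> s)"
    using mu_hyp by (rule card_Qset_ge)
  also have "card (Qset \<mu> s) = card (Pset \<mu> s)"
    unfolding Pset_def by (intro card_image[symmetric] inj_on_S_Qset)
  also have "Pset \<mu> s = {p \<in> Pset \<mu> s. prime p}"
    by (auto simp: Pset_def Qset_def prime_S)
  finally show "b1 + b2 + l \<le> card {p \<in> Pset \<mu> (b1 + b2 + l). prime p}"
    by (simp add: s_def)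
  show "l \<le> card {p \<in> Pset \<mu> (b1 + b2 + l). useful C1 C2 p}"
    using C card unfolding s_def by (intro card_useful_ge[of C1 C2 b1 b2]) auto
next
  obtain N where "N > 1" and N: "\<And>s::nat. real s \<ge> N \<Longrightarrow> real (nmin \<mu> s) \<le> 4 * (real s * ln s)"
    using nmin_le_eventually[of \<mu>] by blast
  \<comment> \<open>The 8 is 2 * 4, from \<open>q < 2 * nmin \<mu> s\<close> and the bound on
    \<open>nmin\<close>. The constants are uniform because \<open>Pset\<close> depends only on
    \<open>\<mu>\<close> and the sum \<open>s\<close>.\<close>
  have "real p \<le> 8 powr 1.89 * real s powr 1.89 * ln s powr 1.89"
    if "real s \<ge> N" "p \<in> Pset \<mu> s" for s p :: nat
  proof -
    obtain q where q: "q \<in> Qset \<mu> s" "p = S q"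
      using \<open>p \<in> Pset \<mu> s\<close> by (auto simp: Pset_def)
    have "real p \<le> real q powr 1.89"
      using q by (simp add: Qset_def)
    also have "\<dots> \<le> (2 * real (nmin \<mu> s)) powr 1.89"
      using q by (intro powr_mono2) (auto simp: Qset_def)
    also have "\<dots> \<le> (8 * (real s * ln s)) powr 1.89"
      using N[OF \<open>real s \<ge> N\<close>] by (intro powr_mono2) auto
    also have "\<dots> = 8 powr 1.89 * real s powr 1.89 * ln s powr 1.89"
      using \<open>N > 1\<close> \<open>real s \<ge> N\<close> by (simp add: powr_mult)
    finally show ?thesis .
  qed
  then show "\<exists>K N :: real. \<forall>C1 C2 \<beta>1 \<beta>2 l :: nat.
            C1 > 0 \<longrightarrow> C2 > 0 \<longrightarrow> log 2 (real C1) \<le> real \<beta>1 \<longrightarrow> log 2 (real C2) \<le> real \<beta>2 \<longrightarrow>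
            real (\<beta>1 + \<beta>2 + l) \<ge> N \<longrightarrow>
            (\<forall>p \<in> Pset \<mu> (\<beta>1 + \<beta>2 + l).
               real p \<le> K * real (\<beta>1 + \<beta>2 + l) powr 1.89 * ln (real (\<beta>1 + \<beta>2 + l)) powr 1.89)"
    by blast
qed

end
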